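(* Let $S:\mathbb{R}\rightarrow\mathbb{R}$ be locally bounded and subadditive with $S(0)=0$. Suppose that $S$ satisfies the weak Heiberg-Seneta condition $(WHS)$, and that $S^{\ast}(t_{n})\rightarrow 0$ for some sequence $t_{n}\uparrow 0$. Then $S$ and its sublinear envelope $S^{\ast}$ are continuous, and further both $S^{\ast}|\mathbb{R}_{+}$ and $S^{\ast}|\mathbb{R}_{-}$ are linear.
   Context: A function $S:\mathbb{R}\to\mathbb{R}$ is subadditive if $S(x+y)\le S(x)+S(y)$ for all $x,y$. Locally bounded means bounded on some neighbourhood of each point. $\mathbb{R}_{+}=[0,\infty)$, $\mathbb{R}_{-}=(-\infty,0]$; a function on $D\subseteq\mathbb{R}$ is linear if it has the form $x\mapsto cx$ on $D$ for some $c\in\mathbb{R}$. The (upper) sublinear envelope of $S$ is $$S^{\ast}(x):=\limsup_{n\rightarrow\infty}nS(x/n)\qquad(x\in\mathbb{R}),$$ a priori with values in $(-\infty,+\infty]$. The notation $t_{n}\uparrow 0$ means that $t_{n}<0$ and $t_{n}$ increases to $0$. Locally Steinhaus-Weil sets: a set $\Sigma\subseteq\mathbb{R}$ is locally Steinhaus-Weil (SW) if for all $x,y\in\Sigma$ and all sufficiently small $\delta>0$, writing $\Sigma_{z}^{\delta}:=\Sigma\cap(z-\delta,z+\delta)$ for $z=x,y$, the point $x+y$ is interior to $\Sigma_{x}^{\delta}+\Sigma_{y}^{\delta}$ and the point $x-y$ is interior to $\Sigma_{x}^{\delta}-\Sigma_{y}^{\delta}$. Condition $(WHS)$: there is a locally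 SW set $\Sigma\subseteq(0,\infty)$ accumulating at $0$ (i.e. $0$ is an accumulation point of $\Sigma$) such that $$\gamma_{S}^{\Sigma}:=\limsup_{t\downarrow 0,\ t\in\Sigma}\frac{S(t)}{t}<\infty.$$ *)

theory Defs
  imports "HOL-Analysis.Analysis"
begin

definition subadditive_fun :: "(real \<Rightarrow> real) \<Rightarrow> bool" where
  "subadditive_fun S \<longleftrightarrow> (\<forall>x y. S (x + y) \<le> S x + S y)"

definition loc_bounded :: "(real \<Rightarrow> real) \<Rightarrow> bool" where
  "loc_bounded S \<longleftrightarrow> (\<forall>x. \<exists>U. open U \<and> x \<in> U \<and> bounded (S ` U))"

(* Values are extended reals, since the upper limit may be infinite. *)
definition sublinear_envelope :: "(real \<Rightarrow> real) \<Rightarrow> real \<Rightarrow> ereal" where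
  "sublinear_envelope S x = limsup (\<lambda>n. ereal (real n * S (x / real n)))"

definition nbhd_part :: "real set \<Rightarrow> real \<Rightarrow> real \<Rightarrow> real set" where
  "nbhd_part \<Sigma> z \<delta> = \<Sigma> \<inter> {z - \<delta> <..< z + \<delta>}"

definition locally_SW :: "real set \<Rightarrow> bool" where
  "locally_SW \<Sigma> \<longleftrightarrow>
     (\<forall>x\<in>\<Sigma>. \<forall>y\<in>\<Sigma>. \<forall>\<^sub>F \<delta> in at_right 0.
        x + y \<in> interior {a + b |a b. a \<in> nbhd_part \<Sigma> x \<delta> \<and> b \<in> nbhd_part \<Sigma> y \<delta>} \<and>
        x - y \<in> interior {a - b |a b. a \<in> nbhd_part \<Sigma> x \<delta> \<and> b \<in> nbhd_part \<Sigma> y \<delta>})"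

definition gamma_on :: "(real \<Rightarrow> real) \<Rightarrow> real set \<Rightarrow> ereal" where
  "gamma_on S \<Sigma> = Limsup (at 0 within (\<Sigma> \<inter> {0<..})) (\<lambda>t. ereal (S t / t))"

definition WHS :: "(real \<Rightarrow> real) \<Rightarrow> bool" where
  "WHS S \<longleftrightarrow>
     (\<exists>\<Sigma>. \<Sigma> \<subseteq> {0<..} \<and> locally_SW \<Sigma> \<and> 0 islimpt \<Sigma> \<and> gamma_on S \<Sigma> < \<infinity>)"

(* In particular, an extended-real function that is linear on D is finite on D. *)
definition ereal_linear_on :: "real set \<Rightarrow> (real \<Rightarrow> ereal) \<Rightarrow> bool" where
  "ereal_linear_on D f \<longleftrightarrow> (\<exists>c::real. \<forall>x\<in>D. f x = ereal (c * x))"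

end

theory Submission
  imports Defs
begin

text \<open>
  Multiples of small points satisfying \<open>S s \<le> c * s\<close> form a dense set on which the same
  bound holds. The sequence \<open>t n\<close> provides such points on the negative side: finiteness of the
  envelope at a single \<open>x < 0\<close> gives \<open>S (x / n) \<le> B / n\<close> for large \<open>n\<close>. By \<open>WHS\<close>
  there are intervals arbitrarily close to \<open>0\<close> on which \<open>S u \<le> c * u\<close>; shifting them back to
  the origin by the dense negative set bounds \<open>S\<close> near \<open>0\<close> from above by small numbers, so \<open>S\<close>
  is continuous at \<open>0\<close>, hence everywhere. By density and continuity \<open>S x / \<bar>x\<bar>\<close> is then bounded
  above on each half-line, and by a Fekete argument \<open>n * S (x / n)\<close> converges to \<open>c * x\<close> with
  \<open>c\<close> the supremum of \<open>S x / x\<close>.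
\<close>

section \<open>Subadditive functions: reflection, multiples and dense linear bounds\<close>

lemma subadditive_funD: "subadditive_fun S \<Longrightarrow> S (x + y) \<le> S x + S y"
  by (simp add: subadditive_fun_def)

text \<open>Transfers results about the positive half-line to the negative one.\<close>

lemma subadditive_fun_reflect:
  assumes "subadditive_fun S"
  shows "subadditive_fun (\<lambda>x. S (- x))"
  unfolding subadditive_fun_def
proof (intro allI)
  fix x y
  show "S (- (x + y)) \<le> S (- x) + S (- y)"
    using subadditive_funD[OF assms, of "- x" "- y"] by simp
qed

lemma subadditive_fun_multiple:
  assumes "subadditive_fun S" and "S 0 \<le> 0"
  shows "S (real n * x) \<le> real n * S x"
proof (induction n)
  case 0
  then show ?case using assms by simp
next
  case (Suc n)
  then show ?case
    using subadditive_funD[OF assms(1), of x "real n * x"] by (simp add: algebra_simps)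
qed

text \<open>The bound passes from \<open>s\<close> to its multiples, and the largest multiple of
  \<open>s\<close> not exceeding \<open>x\<close> misses \<open>x\<close> by less than
  \<open>s\<close>. Taking \<open>s < min e x\<close> makes this gap smaller than \<open>e\<close>
  and the multiple positive.\<close>

lemma linear_bound_dense:
  assumes S: "subadditive_fun S" "S 0 \<le> 0"
    and small: "\<And>e. e > 0 \<Longrightarrow> \<exists>s. 0 < s \<and> s < e \<and> S s \<le> c * s"
    and "x > 0" "e > 0"
  obtains y where "0 < y" "x - e < y" "y \<le> x" "S y \<le> c * y"
proof -
  obtain s where s: "0 < s" "s < min e x" "S s \<le> c * s"
    using small[of "min e x"] assms(4,5) by auto
  define m where "m = nat \<lfloor>x / s\<rfloor>"
  have m: "real m \<le> x / s" "x / s < real m + 1"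
    using s \<open>x > 0\<close> by (auto simp: m_def)
  have "real m * s \<le> x" "x < real m * s + s"
    using m s by (auto simp: field_simps)
  moreover have "S (real m * s) \<le> c * (real m * s)"
  proof -
    have "S (real m * s) \<le> real m * S s" by (rule subadditive_fun_multiple[OF S])
    also have "\<dots> \<le> real m * (c * s)" using s by (intro mult_left_mono) auto
    finally show ?thesis by (simp add: algebra_simps)
  qed
  ultimately show ?thesis using that[of "real m * s"] s by linarith
qed

text \<open>Points satisfying the bound approach \<open>x\<close> from below, and continuity carries
  the bound to the limit.\<close>

lemma linear_bound_all:
  assumes S: "subadditive_fun S" "S 0 \<le> 0" and "continuous_on UNIV S"
    and small: "\<And>e. e > 0 \<Longrightarrow> \<exists>s. 0 < s \<and> s < e \<and> S s \<le> c * s"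
    and "x > 0"
  shows "S x \<le> c * x"
proof -
  have "\<exists>y. x - 1 / real (Suc n) < y \<and> y \<le> x \<and> S y \<le> c * y" for n
    using linear_bound_dense[OF S small \<open>x > 0\<close>, of "1 / real (Suc n)"] by fastforce
  then obtain y where y: "\<And>n. x - 1 / real (Suc n) < y n" "\<And>n. y n \<le> x"
      "\<And>n. S (y n) \<le> c * y n"
    by metis
  have "(\<lambda>n. x - 1 / real (Suc n)) \<longlonglongrightarrow> x - 0"
    by (intro tendsto_diff tendsto_const LIMSEQ_Suc lim_1_over_n)
  then have "y \<longlonglongrightarrow> x"
    by (intro tendsto_sandwich[of "\<lambda>n. x - 1 / real (Suc n)" y _ "\<lambda>_. x"])
       (use less_imp_le[OF y(1)] y(2) in simp_all)
  moreover from this have "(\<lambda>n. S (y n)) \<longlonglongrightarrow> S x"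
    using assms(3) by (intro continuous_on_tendsto_compose[of UNIV S]) auto
  ultimately show ?thesis
    using y(3) by (intro LIMSEQ_le[of "\<lambda>n. S (y n)" _ "\<lambda>n. c * y n"] tendsto_mult_left) auto
qed

text \<open>Upper bounds near 0 suffice because
  \<open>- S (x - y) \<le> S y - S x \<le> S (y - x)\<close>.\<close>

lemma subadditive_fun_continuous:
  assumes S: "subadditive_fun S" "S 0 = 0"
    and small: "\<And>e. e > 0 \<Longrightarrow> \<forall>\<^sub>F v in nhds 0. S v \<le> e"
  shows "continuous_on UNIV S"
proof -
  have "isCont S x" for x
    unfolding isCont_def LIM_eq
  proof (intro allI impI)
    fix e :: real assume "e > 0"
    then obtain d where d: "d > 0" "\<And>v. \<bar>v\<bar> < d \<Longrightarrow> S v \<le> e / 2"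
      using small[of "e / 2"] by (auto simp: eventually_nhds_metric)
    have "norm (S y - S x) < e" if "norm (y - x) < d" for y
    proof -
      have "S y \<le> S (y - x) + S x" "S x \<le> S (x - y) + S y"
        using subadditive_funD[OF S(1), of "y - x" x] subadditive_funD[OF S(1), of "x - y" y] by auto
      moreover have "S (y - x) \<le> e / 2" "S (x - y) \<le> e / 2"
        using that d(2)[of "y - x"] d(2)[of "x - y"] by (simp_all add: abs_minus_commute)
      ultimately show ?thesis using \<open>e > 0\<close> by (simp add: abs_less_iff)
    qed
    then show "\<exists>s>0. \<forall>y. y \<noteq> x \<and> norm (y - x) < s \<longrightarrow> norm (S y - S x) < e"
      using d(1) by blast
  qed
  then show ?thesis by (simp add: continuous_on_eq_continuous_at)
qed

section \<open>Smallness near the origin from the Heiberg-Seneta condition\<close>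

lemma WHS_small_points:
  assumes "WHS S"
  obtains \<Sigma> c \<eta> where "\<Sigma> \<subseteq> {0<..}" "locally_SW \<Sigma>" "0 islimpt \<Sigma>" "c > 0" "\<eta> > 0"
    "\<And>s. s \<in> \<Sigma> \<Longrightarrow> s < \<eta> \<Longrightarrow> S s \<le> c * s"
proof -
  obtain \<Sigma> where \<Sigma>: "\<Sigma> \<subseteq> {0<..}" "locally_SW \<Sigma>" "0 islimpt \<Sigma>" "gamma_on S \<Sigma> < \<infinity>"
    using assms by (auto simp: WHS_def)
  obtain k where k: "gamma_on S \<Sigma> < ereal k"
    using less_PInf_Ex_of_nat[of "gamma_on S \<Sigma>"] \<Sigma>(4) by auto
  \<comment> \<open>The maximum with 1 makes \<open>c\<close> positive, so that inequalities can
    later be multiplied by it.\<close>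
  define c where "c = max k 1"
  have "gamma_on S \<Sigma> < ereal c"
    using k by (rule less_le_trans) (simp add: c_def)
  then have "\<forall>\<^sub>F x in at 0 within (\<Sigma> \<inter> {0<..}). ereal (S x / x) < ereal c"
    unfolding gamma_on_def by (rule Limsup_lessD)
  then obtain \<eta> where "\<eta> > 0" and \<eta>: "\<And>x. x \<in> \<Sigma> \<inter> {0<..} \<Longrightarrow> \<bar>x\<bar> < \<eta> \<Longrightarrow> S x / x < c"
    by (auto simp: eventually_at)
  have "S s \<le> c * s" if "s \<in> \<Sigma>" "s < \<eta>" for s
    using \<eta>[of s] that \<Sigma>(1) by (auto simp: field_simps subset_iff)
  moreover have "c > 0" by (simp add: c_def)
  ultimately show ?thesis using that \<Sigma> \<open>\<eta> > 0\<close> by blast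
qed

text \<open>Every \<open>u\<close> near \<open>2 * s\<close> is a sum of two points of
  \<open>\<Sigma>\<close> close to \<open>s\<close>; adding the bounds at these points gives the
  bound at \<open>u\<close>.\<close>

lemma locally_SW_interval_bound:
  assumes "subadditive_fun S" "locally_SW \<Sigma>"
    and bound: "\<And>s. s \<in> \<Sigma> \<Longrightarrow> s < \<eta> \<Longrightarrow> S s \<le> c * s"
    and "s \<in> \<Sigma>" "s < \<eta>"
  obtains \<epsilon> where "\<epsilon> > 0" "\<And>u. \<bar>u - 2 * s\<bar> < \<epsilon> \<Longrightarrow> S u \<le> c * u"
proof -
  have "\<forall>\<^sub>F \<delta> in at_right 0. s + s \<in>
      interior {a + b |a b. a \<in> nbhd_part \<Sigma> s \<delta> \<and> b \<in> nbhd_part \<Sigma> s \<delta>}"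
    using assms(2,4) unfolding locally_SW_def eventually_conj_iff by blast
  \<comment> \<open>This keeps both summands below \<open>\<eta>\<close>, where \<open>bound\<close>
    applies.\<close>
  moreover have "\<forall>\<^sub>F \<delta> in at_right 0. \<delta> < \<eta> - s"
    using assms(5) by (intro order_tendstoD(2)[OF tendsto_ident_at]) auto
  ultimately have "\<forall>\<^sub>F \<delta> in at_right (0::real). \<delta> < \<eta> - s \<and> s + s \<in>
      interior {a + b |a b. a \<in> nbhd_part \<Sigma> s \<delta> \<and> b \<in> nbhd_part \<Sigma> s \<delta>}"
    by eventually_elim auto
  then obtain \<delta> where \<delta>: "\<delta> < \<eta> - s"
      "s + s \<in> interior {a + b |a b. a \<in> nbhd_part \<Sigma> s \<delta> \<and> b \<in> nbhd_part \<Sigma> s \<delta>}"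
    using eventually_happens'[OF trivial_limit_at_right_real] by blast
  then obtain \<epsilon> where \<epsilon>: "\<epsilon> > 0"
      "ball (s + s) \<epsilon> \<subseteq> {a + b |a b. a \<in> nbhd_part \<Sigma> s \<delta> \<and> b \<in> nbhd_part \<Sigma> s \<delta>}"
    by (auto simp: mem_interior)
  have "S u \<le> c * u" if "\<bar>u - 2 * s\<bar> < \<epsilon>" for u
  proof -
    have "u \<in> ball (s + s) \<epsilon>" using that by (simp add: dist_real_def abs_minus_commute)
    then obtain a b where ab: "u = a + b" "a \<in> nbhd_part \<Sigma> s \<delta>" "b \<in> nbhd_part \<Sigma> s \<delta>"
      using \<epsilon>(2) by blast
    then have "S a \<le> c * a" "S b \<le> c * b"
      using \<delta>(1) by (auto simp: nbhd_part_def intro!: bound)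
    then show ?thesis
      using subadditive_funD[OF assms(1), of a b] ab(1) by (simp add: algebra_simps)
  qed
  then show ?thesis using that \<epsilon>(1) by blast
qed

lemma small_near_zero:
  assumes S: "subadditive_fun S" "S 0 = 0"
    and "locally_SW \<Sigma>" "\<Sigma> \<subseteq> {0<..}" "0 islimpt \<Sigma>" "c > 0" "\<eta> > 0"
    and bound: "\<And>s. s \<in> \<Sigma> \<Longrightarrow> s < \<eta> \<Longrightarrow> S s \<le> c * s"
    and "C > 0"
    and neg: "\<And>e. e > 0 \<Longrightarrow> \<exists>s. 0 < s \<and> s < e \<and> S (- s) \<le> C * s"
    and "e > 0"
  shows "\<forall>\<^sub>F v in nhds 0. S v \<le> e"
proof -
  \<comment> \<open>Below, \<open>v + r\<close> and \<open>r\<close> are both at most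
    \<open>3 * s\<close>, so \<open>S v\<close> is at most \<open>3 * (c + C) * s\<close>, which
    \<open>s < q\<close> makes smaller than \<open>e\<close>.\<close>
  define q where "q = min \<eta> (e / (3 * (c + C)))"
  have "q > 0" using assms by (simp add: q_def)
  then obtain s where s: "s \<in> \<Sigma>" "s < q"
    using \<open>0 islimpt \<Sigma>\<close> unfolding islimpt_approachable by (auto simp: dist_real_def)
  have "s > 0" using s assms(4) by auto
  have "s < \<eta>" using s by (simp add: q_def)
  obtain \<epsilon> where \<epsilon>: "\<epsilon> > 0" "\<And>u. \<bar>u - 2 * s\<bar> < \<epsilon> \<Longrightarrow> S u \<le> c * u"
    using locally_SW_interval_bound[OF S(1) assms(3) bound s(1) \<open>s < \<eta>\<close>] by blast
  have "S v \<le> e" if "\<bar>v\<bar> < s" for v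
  proof -
    have "2 * s - v > 0" using that by linarith
    \<comment> \<open>The shift by \<open>r\<close> moves \<open>v\<close> into the interval around
      \<open>2 * s\<close> controlled by \<open>\<epsilon>\<close>, at the cost of
      \<open>S (- r)\<close>.\<close>
    then obtain r where r: "0 < r" "2 * s - v - \<epsilon> < r" "r \<le> 2 * s - v" "S (- r) \<le> C * r"
      using linear_bound_dense[OF subadditive_fun_reflect[OF S(1)] _ neg _ \<epsilon>(1), of "2 * s - v"] S(2)
      by auto
    have "S v \<le> S (v + r) + S (- r)" using subadditive_funD[OF S(1), of "v + r" "- r"] by simp
    also have "S (v + r) \<le> c * (v + r)" using r by (intro \<epsilon>(2)) auto
    also have "c * (v + r) \<le> c * (3 * s)" using r \<open>s > 0\<close> assms by (intro mult_left_mono) auto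
    also note r(4)
    also have "C * r \<le> C * (3 * s)" using r that assms by (intro mult_left_mono) auto
    also have "c * (3 * s) + C * (3 * s) = s * (3 * (c + C))" by (simp add: algebra_simps)
    also have "\<dots> \<le> e"
    proof -
      have "s < e / (3 * (c + C))" using s by (simp add: q_def)
      then show ?thesis using assms by (simp add: pos_less_divide_eq)
    qed
    finally show ?thesis by simp
  qed
  then show ?thesis using \<open>s > 0\<close> by (auto simp: eventually_nhds_metric)
qed

section \<open>Linear limits on a half-line\<close>

text \<open>
  Fekete argument for \<open>T x = S x - c * x\<close>: since \<open>T\<close> is nonpositive on the half-line,
  \<open>T y \<le> m * T u\<close> for \<open>m = \<lfloor>y / u\<rfloor>\<close>, and \<open>y\<close> can be chosen with \<open>T y / y\<close> close to \<open>0\<close>.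
\<close>
lemma half_line_limit:
  assumes S: "subadditive_fun S" "S 0 = 0"
    and K: "\<And>x. x > 0 \<Longrightarrow> S x \<le> K * x"
  obtains c where "\<And>x. x \<ge> 0 \<Longrightarrow> (\<lambda>n. real n * S (x / real n)) \<longlonglongrightarrow> c * x"
proof -
  \<comment> \<open>The bound \<open>K\<close> makes this supremum finite; it is the slope of the
    limit.\<close>
  define c where "c = (SUP x\<in>{0<..}. S x / x)"
  define T where "T x = S x - c * x" for x
  have bdd: "bdd_above ((\<lambda>x. S x / x) ` {0<..})"
    using K by (intro bdd_aboveI2[of _ _ K]) (auto simp: field_simps)
  have T: "subadditive_fun T" "T 0 = 0"
    using S by (auto simp: subadditive_fun_def T_def algebra_simps)
  have T_nonpos: "T x \<le> 0" if "x \<ge> 0" for x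
  proof (cases "x = 0")
    case False
    then have "S x / x \<le> c"
      unfolding c_def using that by (intro cSUP_upper bdd) auto
    then show ?thesis using False that by (simp add: T_def field_simps)
  qed (simp add: T)
  have lim: "(\<lambda>n. real n * T (x / real n)) \<longlonglongrightarrow> 0" if "x > 0" for x
  proof (rule LIMSEQ_I)
    fix e :: real assume "e > 0"
    \<comment> \<open>Chosen so that \<open>2 * n * e' * u = e\<close> for \<open>u = x / n\<close>;
      the factor 2 pays for \<open>m * u\<close> being only at least \<open>y / 2\<close>.\<close>
    define e' where "e' = e / (2 * x)"
    have "e' > 0" using \<open>e > 0\<close> that by (simp add: e'_def)
    then have "c - e' < (SUP x\<in>{0<..}. S x / x)" by (simp add: c_def)
    then obtain y where "y > 0" "c - e' < S y / y"
      using less_cSUP_iff[OF _ bdd] by (auto simp: greaterThan_iff)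
    then have y: "y > 0" "- e' * y < T y" by (auto simp: T_def field_simps)
    have "norm (real n * T (x / real n) - 0) < e" if n: "n \<ge> nat \<lceil>2 * x / y\<rceil> + 1" for n
    proof -
      define u where "u = x / real n"
      have "n > 0" "real n \<ge> 2 * x / y" using n by linarith+
      then have u: "u > 0" "2 * u \<le> y"
        using \<open>x > 0\<close> y(1) by (auto simp: u_def field_simps)
      define m where "m = nat \<lfloor>y / u\<rfloor>"
      have m: "real m \<le> y / u" "y / u < real m + 1"
        using u y by (auto simp: m_def)
      then have mu: "real m * u \<le> y" "y < real m * u + u"
        using u by (auto simp: field_simps)
      have "T y \<le> T (real m * u) + T (y - real m * u)"
        using subadditive_funD[OF T(1), of "real m * u" "y - real m * u"] by simp
      also have "T (y - real m * u) \<le> 0" using mu by (intro T_nonpos) auto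
      also have "T (real m * u) \<le> real m * T u"
        using T by (intro subadditive_fun_multiple) auto
      finally have Ty: "T y \<le> real m * T u" by simp
      have "T u \<le> 0" using u by (intro T_nonpos) auto
      \<comment> \<open>Here \<open>m * u > y - u \<ge> y / 2\<close>, and multiplying by
        \<open>T u \<le> 0\<close> reverses the inequality.\<close>
      have "real m * T u * u \<le> (y / 2) * T u"
      proof -
        have "(real m * u) * T u \<le> (y / 2) * T u"
          using mu u \<open>T u \<le> 0\<close> by (intro mult_right_mono_neg) auto
        then show ?thesis by (simp add: mult.commute mult.left_commute)
      qed
      moreover have "T y * u \<le> real m * T u * u" using Ty u by (intro mult_right_mono) auto
      moreover have "(- e' * y) * u < T y * u" using y u by (intro mult_strict_right_mono) auto
      ultimately have "y * (- e' * u) < y * (T u / 2)" by (simp add: algebra_simps)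
      then have "- e' * u < T u / 2" using y by (simp only: mult_less_cancel_left_pos)
      then have "real n * (- e' * u) < real n * (T u / 2)"
        using \<open>n > 0\<close> by (intro mult_strict_left_mono) auto
      then have "- e < real n * T u"
        using \<open>n > 0\<close> \<open>x > 0\<close> by (simp add: u_def e'_def)
      moreover have "real n * T u \<le> 0" using \<open>T u \<le> 0\<close> by (simp add: mult_nonneg_nonpos)
      ultimately show ?thesis by (simp add: u_def)
    qed
    then show "\<exists>no. \<forall>n\<ge>no. norm (real n * T (x / real n) - 0) < e" by blast
  qed
  have "(\<lambda>n. real n * S (x / real n)) \<longlonglongrightarrow> c * x" if "x \<ge> 0" for x
  proof (cases "x = 0")
    case False
    have "(\<lambda>n. real n * T (x / real n) + c * x) \<longlonglongrightarrow> 0 + c * x"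
      using False that by (intro tendsto_add lim tendsto_const) auto
    \<comment> \<open>At \<open>n = 0\<close> the left side is \<open>c * x\<close> and the right
      side is 0, so the equality is claimed only eventually.\<close>
    moreover have "\<forall>\<^sub>F n in sequentially. real n * T (x / real n) + c * x = real n * S (x / real n)"
      using eventually_gt_at_top[of 0] by eventually_elim (simp add: T_def field_simps)
    ultimately show ?thesis by (simp add: tendsto_cong)
  qed (simp add: S)
  then show ?thesis using that by blast
qed

section \<open>The envelope and the final assembly\<close>

text \<open>A real \<open>B\<close> above the envelope at \<open>x\<close> eventually exceeds
  \<open>n * S (x / n)\<close>. With \<open>s = - x / n\<close> this reads
  \<open>S (- s) < (B / - x) * s\<close>, so \<open>C = B / - x\<close> works.\<close>

lemma envelope_finite_bound:
  assumes "x < 0" "sublinear_envelope S x < \<infinity>"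
  obtains C where "C > 0" "\<And>e. e > 0 \<Longrightarrow> \<exists>s. 0 < s \<and> s < e \<and> S (- s) \<le> C * s"
proof -
  obtain k where k: "sublinear_envelope S x < ereal k"
    using less_PInf_Ex_of_nat[of "sublinear_envelope S x"] assms(2) by auto
  define B where "B = max k 1"
  have "sublinear_envelope S x < ereal B"
    using k by (rule less_le_trans) (simp add: B_def)
  then have ev: "\<forall>\<^sub>F n in sequentially. ereal (real n * S (x / real n)) < ereal B"
    unfolding sublinear_envelope_def by (rule Limsup_lessD)
  have "\<exists>s. 0 < s \<and> s < e \<and> S (- s) \<le> (B / - x) * s" if "e > 0" for e
  proof -
    have "(\<lambda>n. - x / real n) \<longlonglongrightarrow> 0" by (rule lim_const_over_n)
    then have "\<forall>\<^sub>F n in sequentially. - x / real n < e"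
      using that by (rule order_tendstoD(2))
    with ev eventually_gt_at_top[of 0]
    have "\<forall>\<^sub>F n in sequentially. n > 0 \<and> - x / real n < e \<and> real n * S (x / real n) < B"
      by eventually_elim auto
    then obtain n where n: "n > 0" "- x / real n < e" "real n * S (x / real n) < B"
      using eventually_happens'[OF sequentially_bot] by blast
    have "S (x / real n) < B / real n" using n by (simp add: field_simps)
    then have "S (- (- x / real n)) \<le> (B / - x) * (- x / real n)"
      using assms(1) by simp
    moreover have "- x / real n > 0" using n(1) assms(1) by (simp add: divide_neg_pos)
    ultimately show ?thesis using n(2) by blast
  qed
  moreover have "B / - x > 0" unfolding B_def using assms(1) by (intro divide_pos_pos) auto
  ultimately show ?thesis using that by blast
qed

theorem theorem4:
  fixes S :: "real \<Rightarrow> real" and t :: "nat \<Rightarrow> real"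
  assumes "loc_bounded S"
    and "subadditive_fun S"
    and "S 0 = 0"
    and "WHS S"
    and "\<And>n. t n < 0" and "incseq t" and "t \<longlonglongrightarrow> 0"
    and "(\<lambda>n. sublinear_envelope S (t n)) \<longlonglongrightarrow> 0"
  shows "continuous_on UNIV S \<and> continuous_on UNIV (sublinear_envelope S) \<and>
    ereal_linear_on {0..} (sublinear_envelope S) \<and>
    ereal_linear_on {..0} (sublinear_envelope S)"
proof -
  note S = assms(2,3)
  have S': "subadditive_fun (\<lambda>x. S (- x))" by (rule subadditive_fun_reflect[OF S(1)])
  \<comment> \<open>Convergence to 0 gives a negative point where the envelope is below infinity,
    hence the slope \<open>C\<close> on the negative side.\<close>
  have "\<forall>\<^sub>F n in sequentially. sublinear_envelope S (t n) < \<infinity>"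
    using assms(8) by (rule order_tendstoD(2)) simp
  then obtain n where "sublinear_envelope S (t n) < \<infinity>"
    using eventually_happens'[OF sequentially_bot] by blast
  then obtain C where C: "C > 0" "\<And>e. e > 0 \<Longrightarrow> \<exists>s. 0 < s \<and> s < e \<and> S (- s) \<le> C * s"
    using envelope_finite_bound[OF assms(5)] by metis
  obtain \<Sigma> c \<eta> where \<Sigma>: "\<Sigma> \<subseteq> {0<..}" "locally_SW \<Sigma>" "0 islimpt \<Sigma>" "c > 0" "\<eta> > 0"
    "\<And>s. s \<in> \<Sigma> \<Longrightarrow> s < \<eta> \<Longrightarrow> S s \<le> c * s"
    using WHS_small_points[OF assms(4)] by blast
  have cont: "continuous_on UNIV S"
    by (rule subadditive_fun_continuous[OF S small_near_zero[OF S \<Sigma>(2,1,3-6) C]])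
  have "\<exists>s. 0 < s \<and> s < e \<and> S s \<le> c * s" if "e > 0" for e
  proof -
    have "min e \<eta> > 0" using that \<Sigma> by simp
    then obtain s where "s \<in> \<Sigma>" "s < min e \<eta>"
      using \<Sigma>(3) unfolding islimpt_approachable dist_real_def by (metis diff_0_right abs_less_iff)
    then show ?thesis using \<Sigma>(1,6) by auto
  qed
  then have pos: "S x \<le> c * x" if "x > 0" for x
    using linear_bound_all[OF S(1) _ cont] S(2) that by auto
  have "continuous_on UNIV (\<lambda>x. S (- x))"
    by (rule continuous_on_compose2[OF cont]) (auto intro: continuous_intros)
  then have neg: "S (- x) \<le> C * x" if "x > 0" for x
    using linear_bound_all[OF S', of C] S(2) C(2) that by auto
  obtain a where a: "\<And>x. x \<ge> 0 \<Longrightarrow> (\<lambda>n. real n * S (x / real n)) \<longlonglongrightarrow> a * x"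
    using half_line_limit[OF S pos] by blast
  obtain b where b: "\<And>x. x \<ge> 0 \<Longrightarrow> (\<lambda>n. real n * S (- (x / real n))) \<longlonglongrightarrow> b * x"
    using half_line_limit[OF S' _ neg] S(2) by auto
  \<comment> \<open>For \<open>x < 0\<close> the value comes from the reflected limit at
    \<open>- x\<close>. A single formula in \<open>max\<close> and \<open>min\<close> yields
    continuity across 0 as well as both slopes.\<close>
  have env: "sublinear_envelope S x = ereal (a * max x 0 - b * min x 0)" for x
  proof -
    have "(\<lambda>n. real n * S (x / real n)) \<longlonglongrightarrow> a * max x 0 - b * min x 0"
      using a[of x] b[of "- x"] by (cases "x \<ge> 0") (auto simp: max_def min_def)
    then show ?thesis
      unfolding sublinear_envelope_def by (intro lim_imp_Limsup) auto
  qed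
  have "continuous_on UNIV (sublinear_envelope S)"
    unfolding env[abs_def] by (intro continuous_intros)
  moreover have "ereal_linear_on {0..} (sublinear_envelope S)"
    unfolding ereal_linear_on_def by (rule exI[of _ a]) (simp add: env)
  moreover have "ereal_linear_on {..0} (sublinear_envelope S)"
    unfolding ereal_linear_on_def by (rule exI[of _ "- b"]) (simp add: env)
  ultimately show ?thesis using cont by blast
qed

end
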